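(* Let $S\subset V$ be any subset such that $s\in S$ and $d\notin S$. Then $$C_{opt}(s,d)\ \ge\ R^*_{opt}(S,N_S).$$
   Context: Setting. $V$ is a finite set of vertices and $E$ is a set of directed edges joining vertices of $V$. Each $v\in V$ is associated with a non-empty compact convex set $\mathcal{X}_v\subset\mathbb{R}^n$. For $x_u\in\mathcal{X}_u$, $x_v\in\mathcal{X}_v$ the travel cost of edge $(u,v)$ is $cost(x_u,x_v):=\lVert x_u-x_v\rVert_2$. A path in $(V,E)$ is a sequence of vertices $(v_1,\dots,v_k)$ with $(v_i,v_{i+1})\in E$; given points $x_{v_i}\in\mathcal{X}_{v_i}$, the cost of traveling it is $\sum_{i=1}^{k-1}cost(x_{v_i},x_{v_{i+1}})$. SPP-GCS. For $u\in V$, the SPP-GCS from $u$ to $d$ is to find a path $(v_1,\dots,v_k)$ with $v_1=u$, $v_k=d$ and points $x_{v_i}\in\mathcal{X}_{v_i}$ minimizing the cost of traveling the path; its optimal cost is $C_{opt}(u,d)$ ($+\infty$ if there is no path). The origin is $s\in V$ and the destination is $d\in V$. It is assumed that $(V,E)$ contains at least one path from $s$ to $d$. Heuristic. $h:V\to\mathbb{R}$ is a given admissible function: $h(v)\le C_{opt}(v,d)$ for all $v\in V$, and $h(d)=0$. For $S\subset V$, $N_S:=\{v: u\in S,\ v\notin S,\ (u,v)\in E\}$. Relaxation. The perspective of a compact convex set $\mathcal{X}\subset\mathbb{R}^n$ is $\overline{\mathcal{X}}:=\{(x,\lambda):\lambda\ge 0,\ x\in\lambda\mathcal{X}\}$.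 For $S\subset V$ with $s\in S$, $d\notin S$ and $S'\subseteq N_S$, let $\overline{V}:=S\cup S'$, $\overline{E}:=\{(u,v)\in E: u\in S,\ v\in\overline{V}\}$, and let $\delta^+(v)$, $\delta^-(v)$ be the edges of $\overline{E}$ leaving, respectively entering, $v$. $R^*_{opt}(S,S')$ is the optimal value of the convex program $$\min\ \sum_{(u,v)\in\overline{E}}\lVert z_{uv}-z'_{uv}\rVert_2+\sum_{v\in S'}\alpha_v h(v)$$ over $z_{uv},z'_{uv}\in\mathbb{R}^n$, $y_{uv}\in\mathbb{R}$ for $(u,v)\in\overline{E}$ and $\alpha_v\in\mathbb{R}$ for $v\in S'$, subject to: $\sum_{v\in S'}\alpha_v=1$; $\sum_{(s,v)\in\overline{E}}y_{sv}=1$; $\sum_{(u,v)\in\overline{E}}y_{uv}=\alpha_v$ for each $v\in S'$; $\sum_{(u,v)\in\delta^-(v)}(z'_{uv},y_{uv})=\sum_{(v,u)\in\delta^+(v)}(z_{vu},y_{vu})$ for each $v\in S\setminus\{s\}$; $(z_{uv},y_{uv})\in\overline{\mathcal{X}}_u$ and $(z'_{uv},y_{uv})\in\overline{\mathcal{X}}_v$ for each $(u,v)\in\overline{E}$; $0\le y_{uv}\le 1$ for each $(u,v)\in\overline{E}$; $0\le\alpha_v\le 1$ for each $v\in S'$. *)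

theory Defs
  imports "HOL-Analysis.Analysis"
begin

text \<open>A path is a nonempty list of vertices; repetitions are allowed, and the one-vertex list is a
  path of cost zero.\<close>

definition is_path :: "'v set \<Rightarrow> ('v \<times> 'v) set \<Rightarrow> 'v \<Rightarrow> 'v \<Rightarrow> 'v list \<Rightarrow> bool" where
  "is_path V E u d vs \<longleftrightarrow>
     vs \<noteq> [] \<and> set vs \<subseteq> V \<and> successively (\<lambda>a b. (a, b) \<in> E) vs \<and> hd vs = u \<and> last vs = d"

definition cost :: "real ^ 'n \<Rightarrow> real ^ 'n \<Rightarrow> real" where
  "cost x y = norm (x - y)"

definition travel_cost :: "(real ^ 'n) list \<Rightarrow> real" where
  "travel_cost xs = (\<Sum>i<length xs - 1. cost (xs ! i) (xs ! Suc i))"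

text \<open>One point is chosen for each position of the path, so a vertex visited twice may be assigned
  two different points. The infimum over the empty set is \<open>\<infinity>\<close>.\<close>

definition C_opt ::
  "'v set \<Rightarrow> ('v \<times> 'v) set \<Rightarrow> ('v \<Rightarrow> (real ^ 'n) set) \<Rightarrow> 'v \<Rightarrow> 'v \<Rightarrow> ereal" where
  "C_opt V E X u d =
     Inf {ereal (travel_cost xs) | vs xs.
            is_path V E u d vs \<and> list_all2 (\<lambda>v x. x \<in> X v) vs xs}"

definition admissible ::
  "'v set \<Rightarrow> ('v \<times> 'v) set \<Rightarrow> ('v \<Rightarrow> (real ^ 'n) set) \<Rightarrow> 'v \<Rightarrow> ('v \<Rightarrow> real) \<Rightarrow> bool" where
  "admissible V E X d h \<longleftrightarrow> (\<forall>v\<in>V. ereal (h v) \<le> C_opt V E X v d) \<and> h d = 0"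

definition out_nbrs :: "('v \<times> 'v) set \<Rightarrow> 'v set \<Rightarrow> 'v set" where
  "out_nbrs E S = {v. v \<notin> S \<and> (\<exists>u\<in>S. (u, v) \<in> E)}"

definition perspective :: "(real ^ 'n) set \<Rightarrow> ((real ^ 'n) \<times> real) set" where
  "perspective A = {(x, l). 0 \<le> l \<and> x \<in> (\<lambda>a. l *\<^sub>R a) ` A}"

definition Ebar :: "('v \<times> 'v) set \<Rightarrow> 'v set \<Rightarrow> 'v set \<Rightarrow> ('v \<times> 'v) set" where
  "Ebar E S S' = {(u, v). (u, v) \<in> E \<and> u \<in> S \<and> v \<in> S \<union> S'}"

definition delta_out :: "('v \<times> 'v) set \<Rightarrow> 'v set \<Rightarrow> 'v set \<Rightarrow> 'v \<Rightarrow> ('v \<times> 'v) set" where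
  "delta_out E S S' v = {e \<in> Ebar E S S'. fst e = v}"

definition delta_in :: "('v \<times> 'v) set \<Rightarrow> 'v set \<Rightarrow> 'v set \<Rightarrow> 'v \<Rightarrow> ('v \<times> 'v) set" where
  "delta_in E S S' v = {e \<in> Ebar E S S'. snd e = v}"

definition relax_feasible ::
  "('v \<times> 'v) set \<Rightarrow> ('v \<Rightarrow> (real ^ 'n) set) \<Rightarrow> 'v \<Rightarrow> 'v set \<Rightarrow> 'v set \<Rightarrow>
   ('v \<times> 'v \<Rightarrow> real ^ 'n) \<Rightarrow> ('v \<times> 'v \<Rightarrow> real ^ 'n) \<Rightarrow> ('v \<times> 'v \<Rightarrow> real) \<Rightarrow> ('v \<Rightarrow> real) \<Rightarrow> bool" where
  "relax_feasible E X s S S' z z' y \<alpha> \<longleftrightarrow>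
     (\<Sum>v\<in>S'. \<alpha> v) = 1 \<and>
     (\<Sum>e\<in>delta_out E S S' s. y e) = 1 \<and>
     (\<forall>v\<in>S'. (\<Sum>e\<in>delta_in E S S' v. y e) = \<alpha> v) \<and>
     (\<forall>v\<in>S - {s}. (\<Sum>e\<in>delta_in E S S' v. (z' e, y e)) = (\<Sum>e\<in>delta_out E S S' v. (z e, y e))) \<and>
     (\<forall>(u, v)\<in>Ebar E S S'.
        (z (u, v), y (u, v)) \<in> perspective (X u) \<and> (z' (u, v), y (u, v)) \<in> perspective (X v)) \<and>
     (\<forall>e\<in>Ebar E S S'. 0 \<le> y e \<and> y e \<le> 1) \<and>
     (\<forall>v\<in>S'. 0 \<le> \<alpha> v \<and> \<alpha> v \<le> 1)"

definition relax_objective ::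
  "('v \<times> 'v) set \<Rightarrow> ('v \<Rightarrow> real) \<Rightarrow> 'v set \<Rightarrow> 'v set \<Rightarrow>
   ('v \<times> 'v \<Rightarrow> real ^ 'n) \<Rightarrow> ('v \<times> 'v \<Rightarrow> real ^ 'n) \<Rightarrow> ('v \<Rightarrow> real) \<Rightarrow> real" where
  "relax_objective E h S S' z z' \<alpha> =
     (\<Sum>e\<in>Ebar E S S'. norm (z e - z' e)) + (\<Sum>v\<in>S'. \<alpha> v * h v)"

definition R_opt ::
  "('v \<times> 'v) set \<Rightarrow> ('v \<Rightarrow> (real ^ 'n) set) \<Rightarrow> ('v \<Rightarrow> real) \<Rightarrow> 'v \<Rightarrow> 'v set \<Rightarrow> 'v set \<Rightarrow> ereal" where
  "R_opt E X h s S S' =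
     Inf {ereal (relax_objective E h S S' z z' \<alpha>) | z z' y \<alpha>.
            relax_feasible E X s S S' z z' y \<alpha>}"

end

theory Submission
  imports Defs
begin

text \<open>
  Every path from \<open>s\<close> to \<open>d\<close> with chosen points yields a feasible point of the relaxation whose
  objective is no larger than the cost of traveling the path, so the infimum defining \<open>R_opt\<close> is a
  lower bound for all the costs over which \<open>C_opt\<close> takes its infimum.

  The path starts in \<open>S\<close> and ends outside, so it has a first vertex \<open>w\<close> outside \<open>S\<close>, and
  \<open>w \<in> out_nbrs E S\<close>. The part of the path from \<open>w\<close> on is a path to \<open>d\<close>, so by admissibility it
  costs at least \<open>h w\<close>, which is what the terminal term of the relaxation charges if \<open>\<alpha>\<close> is
  concentrated at \<open>w\<close>.

  The part up to \<open>w\<close> should become a unit flow. If it repeats a vertex this fails: an edge may be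
  used twice, in violation of \<open>y \<le> 1\<close>, and \<open>s\<close> may be left twice. But the loops can be cut out
  (\<open>shortcut_to_distinct_path\<close>). At most one of the visits to each vertex is kept, with the
  point chosen for it; the remaining points form a subsequence of the old ones, so by the triangle
  inequality the cost does not grow. On a path without repetitions the points are a function \<open>f\<close>
  of the vertices, and the indicator \<open>y\<close> of its edges, together with \<open>z = y f(tail)\<close> and
  \<open>z' = y f(head)\<close>, satisfies all the constraints (\<open>path_flow_feasible\<close>); its transport term is
  exactly the cost of the path.
\<close>

section \<open>Travel cost\<close>

lemma travel_cost_single [simp]: "travel_cost [x] = 0"
  by (simp add: travel_cost_def)

lemma travel_cost_Cons_Cons [simp]:
  "travel_cost (x # y # xs) = cost x y + travel_cost (y # xs)"
  by (simp add: travel_cost_def sum.lessThan_Suc_shift del: sum.lessThan_Suc)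

lemma travel_cost_append:
  "travel_cost (xs @ y # ys) = travel_cost (xs @ [y]) + travel_cost (y # ys)"
proof (induction xs)
  case (Cons x xs)
  then show ?case by (cases xs) auto
qed simp

lemma cost_triangle: "cost x z \<le> cost x y + cost y z"
  unfolding cost_def by (metis dist_norm dist_triangle)

lemma cost_hd_last_le_travel_cost:
  "xs \<noteq> [] \<Longrightarrow> cost (hd xs) (last xs) \<le> travel_cost xs"
proof (induction xs rule: induct_list012)
  case (3 x y xs)
  then show ?case using cost_triangle[of x "last (y # xs)" y] by simp
qed (simp_all add: cost_def)

section \<open>Removing repeated vertices from a path\<close>

text \<open>
  The induction runs from the end of the path. When a new first vertex \<open>v\<close> already occurs on the
  shortened path, the piece before that occurrence is dropped, and with it the point just chosen
  for \<open>v\<close>. The new path may thus start at another point of \<open>X v\<close> than \<open>hd xs\<close>, and the edge that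
  the next step prepends has to reach that point instead of \<open>hd xs\<close>. The extra term
  \<open>cost (hd xs) (f (hd vs))\<close> in the bound pays for this detour.
\<close>

lemma shortcut_to_distinct_path:
  assumes "list_all2 (\<lambda>v x. x \<in> X v) vs xs" "vs \<noteq> []" "successively R vs"
  obtains us f where "us \<noteq> []" "distinct us" "successively R us"
    "hd us = hd vs" "last us = last vs" "set us \<subseteq> set vs"
    "\<And>v. v \<in> set us \<Longrightarrow> f v \<in> X v"
    "cost (hd xs) (f (hd vs)) + travel_cost (map f us) \<le> travel_cost xs"
proof -
  have "\<exists>us f. us \<noteq> [] \<and> distinct us \<and> successively R us \<and>
     hd us = hd vs \<and> last us = last vs \<and> set us \<subseteq> set vs \<and>
     (\<forall>v\<in>set us. f v \<in> X v) \<and>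
     cost (hd xs) (f (hd vs)) + travel_cost (map f us) \<le> travel_cost xs"
    using assms
  proof (induction vs xs rule: list_all2_induct)
    case Nil
    then show ?case by simp
  next
    case (Cons v vs x xs)
    show ?case
    proof (cases vs)
      case Nil
      with Cons show ?thesis
        by (intro exI[of _ "[v]"] exI[of _ "\<lambda>_. x"]) (auto simp: cost_def)
    next
      case vs: (Cons v' vs')
      with Cons.hyps obtain x' xs' where xs: "xs = x' # xs'"
        by (auto simp: list_all2_Cons1)
      from Cons.prems vs have R: "R v v'" and "successively R vs" by auto
      then obtain us f where us: "us \<noteq> []" "distinct us" "successively R us"
        "hd us = v'" "last us = last vs" "set us \<subseteq> set vs" "\<forall>v\<in>set us. f v \<in> X v"
        and le: "cost x' (f v') + travel_cost (map f us) \<le> travel_cost xs"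
        using Cons.IH vs xs by auto
      have le': "cost x (f v') + travel_cost (map f us) \<le> travel_cost (x # xs)"
        using le cost_triangle[of x "f v'" x'] by (simp add: xs)
      show ?thesis
      proof (cases "v \<in> set us")
        case False
        let ?f = "f(v := x)"
        have f: "map ?f us = map f us" using False by auto
        obtain us' where us': "us = v' # us'" using us by (cases us) auto
        have "travel_cost (map ?f (v # us)) = cost x (f v') + travel_cost (map f us)"
          unfolding list.map(2) f by (simp add: us')
        then have "cost (hd (x # xs)) (?f (hd (v # vs))) + travel_cost (map ?f (v # us))
            \<le> travel_cost (x # xs)"
          using le' by (simp add: cost_def)
        moreover have "\<forall>u\<in>set (v # us). ?f u \<in> X u"
          using us(7) Cons.hyps(1) by auto
        ultimately show ?thesis
          using us(1-6) False R vs us'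
          by (intro exI[of _ "v # us"] exI[of _ ?f]) (auto simp del: list.map fun_upd_apply)
      next
        case True
        then obtain as bs where split: "us = as @ v # bs" by (meson split_list)
        have "hd (map f (as @ [v])) = f v'"
          using us(4) split by (cases as) auto
        then have "cost (f v') (f v) \<le> travel_cost (map f (as @ [v]))"
          using cost_hd_last_le_travel_cost[of "map f (as @ [v])"] by simp
        moreover have "travel_cost (map f us)
            = travel_cost (map f (as @ [v])) + travel_cost (map f (v # bs))"
          using travel_cost_append[of "map f as" "f v" "map f bs"] by (simp add: split)
        ultimately have "cost x (f v) + travel_cost (map f (v # bs)) \<le> travel_cost (x # xs)"
          using le' cost_triangle[of x "f v" "f v'"] by linarith
        then show ?thesis
          using us split vs
          by (intro exI[of _ "v # bs"] exI[of _ f]) (auto simp: successively_append_iff)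
      qed
    qed
  qed
  then show thesis using that by blast
qed

section \<open>The unit flow along a path\<close>

definition path_edges :: "'v list \<Rightarrow> ('v \<times> 'v) set" where
  "path_edges vs = set (zip vs (tl vs))"

lemma path_edges_Cons_Cons:
  "path_edges (u # v # vs) = insert (u, v) (path_edges (v # vs))"
  by (simp add: path_edges_def)

lemma finite_path_edges: "finite (path_edges vs)"
  by (simp add: path_edges_def)

lemma path_edges_subset_relation:
  "successively (\<lambda>a b. (a, b) \<in> E) vs \<Longrightarrow> path_edges vs \<subseteq> E"
proof (induction vs rule: induct_list012)
  case (3 u v vs)
  then show ?case by (simp add: path_edges_Cons_Cons)
qed (simp_all add: path_edges_def)

lemma map_fst_path_edges: "map fst (zip vs (tl vs)) = butlast vs"
  by (simp add: map_fst_zip_take butlast_conv_take)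

lemma map_snd_path_edges: "map snd (zip vs (tl vs)) = tl vs"
  by (simp add: map_snd_zip_take)

lemma fst_path_edges: "fst ` path_edges vs = set (butlast vs)"
  unfolding path_edges_def by (metis map_fst_path_edges list.set_map)

lemma snd_path_edges: "snd ` path_edges vs = set (tl vs)"
  unfolding path_edges_def by (metis map_snd_path_edges list.set_map)

lemma inj_on_fst_path_edges: "distinct vs \<Longrightarrow> inj_on fst (path_edges vs)"
  unfolding path_edges_def by (metis distinct_butlast distinct_map map_fst_path_edges)

lemma inj_on_snd_path_edges: "distinct vs \<Longrightarrow> inj_on snd (path_edges vs)"
  unfolding path_edges_def by (metis distinct_tl distinct_map map_snd_path_edges)

lemma travel_cost_map_eq_sum_path_edges:
  "distinct vs \<Longrightarrow> travel_cost (map f vs) = (\<Sum>e\<in>path_edges vs. norm (f (fst e) - f (snd e)))"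
proof (induction vs rule: induct_list012)
  case (3 u v vs)
  have "(u, v) \<notin> path_edges (v # vs)"
    using 3(3) by (auto simp: path_edges_def dest: set_zip_leftD)
  then show ?case
    using 3 finite_path_edges[of "v # vs"] by (simp add: path_edges_Cons_Cons cost_def)
qed (simp_all add: path_edges_def travel_cost_def)

text \<open>
  With \<open>g = fst\<close> and \<open>g = snd\<close> this computes the flow out of and into a vertex, for the unit flow
  along a path: on a path without repetitions both projections are injective.
\<close>

lemma sum_indicator_fibre:
  assumes "finite D" "P \<subseteq> D" "inj_on g P"
  shows "(\<Sum>e\<in>{e \<in> D. g e = v}. of_bool (e \<in> P)) = (of_bool (v \<in> g ` P) :: real)"
proof -
  have "(\<Sum>e\<in>{e \<in> D. g e = v}. of_bool (e \<in> P)) = (\<Sum>e\<in>{e \<in> P. g e = v}. (1::real))"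
    using assms by (intro sum.mono_neutral_cong_right) auto
  also have "\<dots> = of_bool (v \<in> g ` P)"
  proof (cases "v \<in> g ` P")
    case True
    then obtain e where "e \<in> P" "g e = v" by blast
    then have "{e \<in> P. g e = v} = {e}" using assms(3) by (auto dest: inj_onD)
    then show ?thesis using True by simp
  next
    case False
    then have empty: "{e \<in> P. g e = v} = {}" by blast
    show ?thesis unfolding empty using False by simp
  qed
  finally show ?thesis .
qed

text \<open>
  The edges off the path carry \<open>(0, 0)\<close>, which lies in the perspective of \<open>X v\<close> only because
  \<open>X v\<close> is nonempty.
\<close>

lemma scaled_point_in_perspective:
  assumes "A \<noteq> {}" "b \<Longrightarrow> a \<in> A"
  shows "(of_bool b *\<^sub>R a, of_bool b) \<in> perspective A"
  using assms by (auto simp: perspective_def)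

text \<open>
  Conservation at \<open>v \<in> S - {s}\<close> holds because such a vertex is neither the first nor the last one of
  the path, hence is entered once and left once, or not visited; and both times the point is \<open>f v\<close>.
\<close>

lemma path_flow_feasible:
  fixes X :: "'v \<Rightarrow> (real ^ 'n) set" and f :: "'v \<Rightarrow> real ^ 'n"
  assumes "finite E" "finite T" "S \<inter> T = {}"
    and X: "\<And>u v. (u, v) \<in> E \<Longrightarrow> X u \<noteq> {} \<and> X v \<noteq> {}"
    and vs: "vs \<noteq> []" "distinct vs" "successively (\<lambda>a b. (a, b) \<in> E) vs"
    and ends: "hd vs = s" "last vs = w" "s \<in> S" "w \<in> T" "set vs \<subseteq> insert w S"
    and f: "\<And>v. v \<in> set vs \<Longrightarrow> f v \<in> X v"
  defines "y \<equiv> \<lambda>e. of_bool (e \<in> path_edges vs)"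
  shows "relax_feasible E X s S T (\<lambda>e. y e *\<^sub>R f (fst e)) (\<lambda>e. y e *\<^sub>R f (snd e)) y
      (\<lambda>v. of_bool (v = w))"
    and "relax_objective E h S T (\<lambda>e. y e *\<^sub>R f (fst e)) (\<lambda>e. y e *\<^sub>R f (snd e))
      (\<lambda>v. of_bool (v = w)) = travel_cost (map f vs) + h w"
proof -
  let ?P = "path_edges vs"
  have w: "w \<notin> S" "w \<noteq> s" using assms(3) ends by auto
  have "butlast vs \<noteq> []" using vs(1) ends w by (cases vs) auto
  then have s_in: "s \<in> set (butlast vs)"
    using ends(1) vs(1) by (metis hd_in_set hd_append append_butlast_last_id)
  have "set vs = insert w (set (butlast vs))"
    using append_butlast_last_id[OF vs(1)] ends(2)
    by (metis list.simps(15) rotate1.simps(2) set_rotate1)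
  moreover have "w \<notin> set (butlast vs)"
    using vs ends(2) by (metis append_butlast_last_id distinct_append disjoint_iff list.set_intros(1))
  ultimately have butlast: "set (butlast vs) = set vs - {w}" by blast
  have tl: "set (tl vs) = set vs - {s}"
    using vs ends(1) by (cases vs) auto
  have w_in: "w \<in> set vs" using ends(2) vs(1) by auto
  have P_vs: "u \<in> set vs \<and> v \<in> set vs" if "(u, v) \<in> ?P" for u v
    using that vs(1) by (auto simp: path_edges_def dest: set_zip_leftD set_zip_rightD list.set_sel(2))
  have P: "?P \<subseteq> Ebar E S T"
  proof
    fix e assume e: "e \<in> ?P"
    moreover have "fst e \<in> S"
      using fst_path_edges[of vs] butlast ends(5) e by blast
    moreover have "snd e \<in> S \<union> T"
      using snd_path_edges[of vs] tl ends(4,5) e by blast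
    ultimately show "e \<in> Ebar E S T"
      using path_edges_subset_relation[OF vs(3)] by (auto simp: Ebar_def)
  qed
  have finE: "finite (Ebar E S T)"
    by (rule finite_subset[OF _ assms(1)]) (auto simp: Ebar_def)
  have out: "(\<Sum>e\<in>delta_out E S T v. y e) = of_bool (v \<in> set vs - {w})" for v
    using sum_indicator_fibre[OF finE P inj_on_fst_path_edges[OF vs(2)], of v]
    by (simp only: y_def delta_out_def fst_path_edges butlast)
  have inn: "(\<Sum>e\<in>delta_in E S T v. y e) = of_bool (v \<in> set vs - {s})" for v
    using sum_indicator_fibre[OF finE P inj_on_snd_path_edges[OF vs(2)], of v]
    by (simp only: y_def delta_in_def snd_path_edges tl)
  have sum_pair: "(\<Sum>e\<in>D. (y e *\<^sub>R g e, y e)) = ((\<Sum>e\<in>D. y e) *\<^sub>R a, \<Sum>e\<in>D. y e)"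
    if "\<And>e. e \<in> D \<Longrightarrow> g e = a" for D and g :: "'v \<times> 'v \<Rightarrow> real ^ 'n" and a
    using that by (simp add: sum_prod scaleR_sum_left)
  have conserve: "(\<Sum>e\<in>delta_in E S T v. (y e *\<^sub>R f (snd e), y e))
      = (\<Sum>e\<in>delta_out E S T v. (y e *\<^sub>R f (fst e), y e))" if "v \<in> S - {s}" for v
  proof -
    have "v \<noteq> w" "v \<noteq> s" using that w by auto
    then have "(\<Sum>e\<in>delta_in E S T v. y e) = (\<Sum>e\<in>delta_out E S T v. y e)"
      by (simp add: inn out)
    moreover have "(\<Sum>e\<in>delta_in E S T v. (y e *\<^sub>R f (snd e), y e))
        = ((\<Sum>e\<in>delta_in E S T v. y e) *\<^sub>R f v, \<Sum>e\<in>delta_in E S T v. y e)"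
      by (rule sum_pair) (simp add: delta_in_def)
    moreover have "(\<Sum>e\<in>delta_out E S T v. (y e *\<^sub>R f (fst e), y e))
        = ((\<Sum>e\<in>delta_out E S T v. y e) *\<^sub>R f v, \<Sum>e\<in>delta_out E S T v. y e)"
      by (rule sum_pair) (simp add: delta_out_def)
    ultimately show ?thesis by simp
  qed
  have persp: "(y (u, v) *\<^sub>R f u, y (u, v)) \<in> perspective (X u) \<and>
      (y (u, v) *\<^sub>R f v, y (u, v)) \<in> perspective (X v)" if "(u, v) \<in> Ebar E S T" for u v
    unfolding y_def using that X[of u v] f P_vs[of u v]
    by (intro conjI scaled_point_in_perspective) (auto simp: Ebar_def)
  have at_T: "(\<Sum>e\<in>delta_in E S T v. y e) = of_bool (v = w)" if "v \<in> T" for v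
    using that ends(3,5) assms(3) w w_in unfolding inn by auto
  have \<alpha>: "(\<Sum>v\<in>T. of_bool (v = w) * g v) = g w" for g :: "'v \<Rightarrow> real"
    using assms(2) ends(4) by (simp add: of_bool_def if_distrib if_distribR sum.delta cong: if_cong)
  show "relax_feasible E X s S T (\<lambda>e. y e *\<^sub>R f (fst e)) (\<lambda>e. y e *\<^sub>R f (snd e)) y
      (\<lambda>v. of_bool (v = w))"
    unfolding relax_feasible_def
  proof (intro conjI)
    show "(\<Sum>v\<in>T. of_bool (v = w)) = (1::real)" using \<alpha>[of "\<lambda>_. 1"] by simp
    show "(\<Sum>e\<in>delta_out E S T s. y e) = 1" using s_in butlast by (simp add: out)
    show "\<forall>v\<in>T. (\<Sum>e\<in>delta_in E S T v. y e) = of_bool (v = w)" using at_T by blast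
    show "\<forall>e\<in>Ebar E S T. 0 \<le> y e \<and> y e \<le> 1" by (simp add: y_def)
  qed (use conserve persp in auto)
  have "(\<Sum>e\<in>Ebar E S T. norm (y e *\<^sub>R f (fst e) - y e *\<^sub>R f (snd e)))
      = (\<Sum>e\<in>?P. norm (f (fst e) - f (snd e)))"
    using finE P by (intro sum.mono_neutral_cong_right) (auto simp: y_def)
  then show "relax_objective E h S T (\<lambda>e. y e *\<^sub>R f (fst e)) (\<lambda>e. y e *\<^sub>R f (snd e))
      (\<lambda>v. of_bool (v = w)) = travel_cost (map f vs) + h w"
    using travel_cost_map_eq_sum_path_edges[OF vs(2), of f] \<alpha>[of h] by (simp add: relax_objective_def)
qed

section \<open>The lower bound\<close>

theorem theorem1:
  fixes V S :: "'v set" and E :: "('v \<times> 'v) set" and X :: "'v \<Rightarrow> (real ^ 'n) set"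
    and h :: "'v \<Rightarrow> real" and s d :: 'v
  assumes "finite V" and "E \<subseteq> V \<times> V"
    and "\<And>v. v \<in> V \<Longrightarrow> X v \<noteq> {} \<and> compact (X v) \<and> convex (X v)"
    and "s \<in> V" and "d \<in> V"
    and "\<exists>vs. is_path V E s d vs"
    and "admissible V E X d h"
    and "S \<subseteq> V" and "s \<in> S" and "d \<notin> S"
  shows "C_opt V E X s d \<ge> R_opt E X h s S (out_nbrs E S)"
proof -
  let ?T = "out_nbrs E S"
  have "R_opt E X h s S ?T \<le> ereal (travel_cost xs)"
    if path: "is_path V E s d vs" and pts: "list_all2 (\<lambda>v x. x \<in> X v) vs xs" for vs xs
  proof -
    have vs: "vs \<noteq> []" "set vs \<subseteq> V" "successively (\<lambda>a b. (a, b) \<in> E) vs" "hd vs = s" "last vs = d"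
      using path by (auto simp: is_path_def)
    have "\<exists>v\<in>set vs. v \<notin> S" using vs assms(10) last_in_set by metis
    then obtain as w bs where split: "vs = as @ w # bs" and w: "w \<notin> S" and as: "\<forall>v\<in>set as. v \<in> S"
      using split_list_first_prop[of vs "\<lambda>v. v \<notin> S"] by auto
    have "as \<noteq> []" using split vs(4) w assms(9) by auto
    then have "(last as, w) \<in> E" "last as \<in> S"
      using vs(3) as by (auto simp: split successively_append_iff)
    then have wT: "w \<in> ?T" using w by (auto simp: out_nbrs_def)
    obtain xas xw xbs where xs: "xs = xas @ xw # xbs"
      and pa: "list_all2 (\<lambda>v x. x \<in> X v) as xas" and pw: "xw \<in> X w"
      and pb: "list_all2 (\<lambda>v x. x \<in> X v) bs xbs"
      using pts by (auto simp: split list_all2_append1 list_all2_Cons1)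
    have "is_path V E w d (w # bs)"
      using vs by (auto simp: split is_path_def successively_append_iff)
    moreover have "list_all2 (\<lambda>v x. x \<in> X v) (w # bs) (xw # xbs)" using pw pb by simp
    ultimately have "C_opt V E X w d \<le> ereal (travel_cost (xw # xbs))"
      unfolding C_opt_def by (intro Inf_lower) blast
    moreover have "ereal (h w) \<le> C_opt V E X w d"
      using assms(7) vs(2) split by (auto simp: admissible_def)
    ultimately have hw: "h w \<le> travel_cost (xw # xbs)"
      by (metis ereal_less_eq(3) order_trans)
    have "list_all2 (\<lambda>v x. x \<in> X v) (as @ [w]) (xas @ [xw])"
      using pa pw by (simp add: list_all2_appendI)
    moreover have "successively (\<lambda>a b. (a, b) \<in> E) (as @ [w])"
      using vs(3) by (auto simp: split successively_append_iff)
    ultimately obtain us f where us: "us \<noteq> []" "distinct us" "successively (\<lambda>a b. (a, b) \<in> E) us"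
      "hd us = hd (as @ [w])" "last us = last (as @ [w])" "set us \<subseteq> set (as @ [w])"
      "\<And>v. v \<in> set us \<Longrightarrow> f v \<in> X v"
      and le: "cost (hd (xas @ [xw])) (f (hd (as @ [w]))) + travel_cost (map f us)
        \<le> travel_cost (xas @ [xw])"
      using shortcut_to_distinct_path[where vs = "as @ [w]"] by (metis snoc_eq_iff_butlast)
    have us_ends: "hd us = s" "last us = w" "set us \<subseteq> insert w S"
      using us(4-6) vs(4) \<open>as \<noteq> []\<close> as by (auto simp: split)
    have "finite E" using assms(1,2) finite_subset by blast
    moreover have "finite ?T"
      by (rule finite_subset[OF _ assms(1)]) (use assms(2) in \<open>auto simp: out_nbrs_def\<close>)
    moreover have "S \<inter> ?T = {}" by (auto simp: out_nbrs_def)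
    moreover have "X u \<noteq> {} \<and> X v \<noteq> {}" if "(u, v) \<in> E" for u v
      using that assms(2,3) by blast
    ultimately have flow: "\<exists>z z' y \<alpha>. relax_feasible E X s S ?T z z' y \<alpha> \<and>
        relax_objective E h S ?T z z' \<alpha> = travel_cost (map f us) + h w"
      using path_flow_feasible[of E ?T S X us s w f] us us_ends assms(9) wT by blast
    have "R_opt E X h s S ?T \<le> ereal (travel_cost (map f us) + h w)"
      unfolding R_opt_def using flow by (intro Inf_lower CollectI) metis
    also have "travel_cost (map f us) + h w \<le> travel_cost xs"
    proof -
      have "travel_cost (map f us) \<le> travel_cost (xas @ [xw])"
        using le by (smt (verit) cost_def norm_ge_zero)
      then show ?thesis using hw travel_cost_append[of xas xw xbs] by (simp add: xs)
    qed
    finally show ?thesis by simp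
  qed
  then show ?thesis
    unfolding C_opt_def by (intro Inf_greatest) auto
qed

end
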